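(* Let $d, T \ge 1$ be integers, let $\ell$ be an integer with $1 \le \ell \le d$, and let $X_1,\dots,X_T$ be real matrices with $X_t \in \mathbb{R}^{d\times n_t}$ (where $n_t \ge 1$). Let $C = \sum_{t=1}^{T} X_t X_t^T \in \mathbb{R}^{d\times d}$, with eigenvalues $\lambda_1 \ge \lambda_2 \ge \dots \ge \lambda_d$ (counted with multiplicity). Let $\tilde C = \tilde C_T$ be the output of Frequent Directions with parameter $\ell$ on the stream $X_1,\dots,X_T$. Then, simultaneously for all integers $k$ with $0 \le k < \ell$, $$\|C - \tilde C\| \le \frac{1}{\ell - k}\sum_{i=k+1}^{d} \lambda_i ,$$ where $\|\cdot\|$ denotes the spectral (operator 2-) norm.
   Context: Frequent Directions with parameter $\ell$ produces a sequence of symmetric positive semidefinite matrices $\tilde C_0, \tilde C_1, \dots, \tilde C_T \in \mathbb{R}^{d\times d}$ as follows. Set $\tilde C_0 = 0$. For $t = 1,\dots,T$, let $\tilde C_{t-1} + X_t X_t^T = U_t \Lambda_t U_t^T$ be an eigendecomposition, with $U_t$ orthogonal and $\Lambda_t$ diagonal, and let $\lambda^t_\ell$ be the $\ell$-th largest eigenvalue (counted with multiplicity) of $\tilde C_{t-1} + X_t X_t^T$. Define $$\tilde C_t = U_t \cdot \max(\Lambda_t - \lambda^t_\ell I,\, 0)\cdot U_t^T,$$ where $I$ is the $d \times d$ identity matrix and the maximum with $0$ is taken entrywise (so each diagonal entry $\mu$ of $\Lambda_t$ is replaced by $\max(\mu - \lambda^t_\ell, 0)$). The output is $\tilde C = \tilde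 C_T$. *)

theory Defs
  imports "Jordan_Normal_Form.Char_Poly"
begin

text \<open>
  Real eigenvalues counted with algebraic multiplicity, in decreasing order. For a symmetric
  matrix of dimension \<open>d\<close> the list has length \<open>d\<close>, since the characteristic polynomial splits
  over the reals.
\<close>

definition eigenvalues_desc :: "real mat \<Rightarrow> real list" where
  "eigenvalues_desc A = rev (sorted_list_of_multiset (proots (char_poly A)))"

text \<open>Indexing is from 1: \<open>nth_eigenvalue A 1\<close> is the largest eigenvalue.\<close>

definition nth_eigenvalue :: "real mat \<Rightarrow> nat \<Rightarrow> real" where
  "nth_eigenvalue A i = eigenvalues_desc A ! (i - 1)"

definition euclidean_norm :: "real vec \<Rightarrow> real" where
  "euclidean_norm v = sqrt (scalar_prod v v)"

text \<open>The supremum is over a nonempty set only if \<open>A\<close> has at least one column.\<close>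

definition spectral_norm :: "real mat \<Rightarrow> real" where
  "spectral_norm A =
     (SUP v \<in> {v \<in> carrier_vec (dim_col A). euclidean_norm v = 1}. euclidean_norm (A *\<^sub>v v))"

definition is_eigendecomposition :: "nat \<Rightarrow> real mat \<Rightarrow> real mat \<Rightarrow> real mat \<Rightarrow> bool" where
  "is_eigendecomposition d A U L \<longleftrightarrow>
     U \<in> carrier_mat d d \<and> L \<in> carrier_mat d d \<and>
     transpose_mat U * U = 1\<^sub>m d \<and> U * transpose_mat U = 1\<^sub>m d \<and>
     diagonal_mat L \<and> A = U * L * transpose_mat U"

definition stream_covariance :: "nat \<Rightarrow> nat \<Rightarrow> (nat \<Rightarrow> real mat) \<Rightarrow> real mat" where
  "stream_covariance d T X =
     mat d d (\<lambda>(i, j). \<Sum>t = 1..T. (X t * transpose_mat (X t)) $$ (i, j))"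

definition fd_step :: "nat \<Rightarrow> nat \<Rightarrow> real mat \<Rightarrow> real mat \<Rightarrow> real mat \<Rightarrow> bool" where
  "fd_step d l Y A B \<longleftrightarrow>
     (\<exists>U L. is_eigendecomposition d (A + Y * transpose_mat Y) U L \<and>
        B = U * map_mat (\<lambda>x. max x 0)
                  (L - nth_eigenvalue (A + Y * transpose_mat Y) l \<cdot>\<^sub>m 1\<^sub>m d)
              * transpose_mat U)"

text \<open>
  The eigendecomposition in each step is not unique, so a run is a relation: \<open>Ct 0, \<dots>, Ct T\<close> is
  an admissible run if every step uses some eigendecomposition.
\<close>

definition frequent_directions ::
    "nat \<Rightarrow> nat \<Rightarrow> nat \<Rightarrow> (nat \<Rightarrow> real mat) \<Rightarrow> (nat \<Rightarrow> real mat) \<Rightarrow> bool" where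
  "frequent_directions d l T X Ct \<longleftrightarrow>
     Ct 0 = 0\<^sub>m d d \<and> (\<forall>t \<in> {1..T}. fd_step d l (X t) (Ct (t - 1)) (Ct t))"

end

theory Submission
  imports Defs "Jordan_Normal_Form.Schur_Decomposition" "HOL-Analysis.L2_Norm"
begin

text \<open>
  Write \<open>\<delta>\<close> for the sum of the thresholds subtracted in the \<open>T\<close> steps. Each step removes a
  matrix whose eigenvalues lie between \<open>0\<close> and its threshold, at least \<open>l\<close> of them being equal
  to the threshold. Summing over the steps, \<open>C - Ct T\<close> has norm at most \<open>\<delta>\<close> and trace at least
  \<open>l * \<delta>\<close>. On the other hand \<open>Ct T\<close> is positive semidefinite, so its trace is at least the sum
  of its quadratic form over the top \<open>k\<close> unit eigenvectors of \<open>C\<close>; by the norm bound this is at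
  least the sum of the top \<open>k\<close> eigenvalues of \<open>C\<close> minus \<open>k * \<delta>\<close>. Hence \<open>l * \<delta>\<close> is at most the
  sum of the remaining eigenvalues plus \<open>k * \<delta>\<close>.
\<close>

section \<open>Orthogonal triangularization\<close>

text \<open>Gram-Schmidt applied to a basis beginning with \<open>v\<close> keeps \<open>v\<close>
  in front, and normalizing only rescales it. The factor \<open>c\<close> stays unspecified because
  every multiple of an eigenvector satisfies the same eigenvalue equation.\<close>

lemma orthonormal_completion:
  fixes v :: "real vec"
  assumes v: "v \<in> carrier_vec n" and v0: "v \<noteq> 0\<^sub>v n"
  obtains W c where "W \<in> carrier_mat n n" "transpose_mat W * W = 1\<^sub>m n" "col W 0 = c \<cdot>\<^sub>v v"
proof -
  interpret cof_vec_space n "TYPE(real)" .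
  define b where "b = basis_completion v"
  define ws where "ws = gram_schmidt n b"
  note bc = basis_completion[OF v v0, folded b_def]
  have n: "n \<noteq> 0" using v v0 by auto
  then obtain vs where bv: "b = v # vs" using bc by (cases b) auto
  have ws: "set ws \<subseteq> carrier_vec n" "corthogonal ws" "length ws = n"
    using gram_schmidt_result[OF bc(2,4,5) refl, folded ws_def] bc(6) by auto
  have "hd ws = v"
    using gram_schmidt_hd[OF v, of vs, folded bv] unfolding ws_def .
  then have ws0: "ws ! 0 = v"
    using ws n by (cases ws) auto
  have wsc: "ws ! i \<in> carrier_vec n" if "i < n" for i
    using ws that by auto
  \<comment> \<open>The conjugate in \<open>corthogonal\<close> is trivial over the reals. The case
    \<open>i = j\<close> of the equivalence makes every vector nonzero, so it can be
    normalized.\<close>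
  have orth: "(ws ! i \<bullet> ws ! j = 0) = (i \<noteq> j)" if "i < n" "j < n" for i j
  proof -
    have "conjugate (ws ! j) = ws ! j"
      by (rule eq_vecI) auto
    then show ?thesis
      using corthogonalD[OF ws(2), of i j] that ws by simp
  qed
  have pos: "ws ! i \<bullet> ws ! i > 0" if "i < n" for i
    using orth[OF that that] by (simp add: scalar_prod_def sum_nonneg order_less_le)
  define us where "us = map (\<lambda>w. (1 / sqrt (w \<bullet> w)) \<cdot>\<^sub>v w) ws"
  define W where "W = mat_of_cols n us"
  have W: "W \<in> carrier_mat n n"
    unfolding W_def us_def using ws by auto
  have colW: "col W i = (1 / sqrt (ws ! i \<bullet> ws ! i)) \<cdot>\<^sub>v (ws ! i)" if "i < n" for i
    unfolding W_def us_def using that ws wsc[OF that] by (subst col_mat_of_cols) auto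
  have "transpose_mat W * W = 1\<^sub>m n"
  proof (rule eq_matI)
    fix i j
    assume ij: "i < dim_row (1\<^sub>m n :: real mat)" "j < dim_col (1\<^sub>m n :: real mat)"
    then have "(transpose_mat W * W) $$ (i, j) = col W i \<bullet> col W j"
      using W by auto
    also have "\<dots> = (1 / sqrt (ws ! i \<bullet> ws ! i)) * ((1 / sqrt (ws ! j \<bullet> ws ! j)) * (ws ! i \<bullet> ws ! j))"
      using ij wsc[of i] wsc[of j] by (simp add: colW)
    also have "\<dots> = 1\<^sub>m n $$ (i, j)"
      using orth[of i j] ij pos[of i] by (auto simp: field_simps)
    finally show "(transpose_mat W * W) $$ (i, j) = 1\<^sub>m n $$ (i, j)" .
  qed (use W in auto)
  then show thesis
    using that[OF W] colW[of 0] n ws0 by auto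
qed

lemma orthogonal_mat_right:
  fixes U :: "'a :: field mat"
  assumes "U \<in> carrier_mat n n" "transpose_mat U * U = 1\<^sub>m n"
  shows "U * transpose_mat U = 1\<^sub>m n"
  using mat_mult_left_right_inverse[of "transpose_mat U" n U] assms by simp

text \<open>Links matrices to forms: through this identity diagonal entries and traces become values
  of the quadratic form on the columns of \<open>U\<close>.\<close>

lemma index_conj_mat:
  assumes A: "A \<in> carrier_mat n n" and U: "U \<in> carrier_mat n n" and ij: "i < n" "j < n"
  shows "(transpose_mat U * A * U) $$ (i, j) = col U i \<bullet> (A *\<^sub>v col U j)"
proof -
  have "(transpose_mat U * A * U) $$ (i, j) = (transpose_mat U * (A * U)) $$ (i, j)"
    using A U by (subst assoc_mult_mat[of _ n n _ n _ n]) auto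
  also have "\<dots> = row (transpose_mat U) i \<bullet> col (A * U) j"
    using A U ij by (intro index_mult_mat(1)) auto
  also have "\<dots> = col U i \<bullet> (A *\<^sub>v col U j)"
    using U ij by (subst col_mult2[OF A U ij(2)]) simp
  finally show ?thesis .
qed

text \<open>
  The library's \<open>schur_decomposition\<close> only promises an invertible change of basis; traces and
  quadratic forms need an orthogonal one.
\<close>

lemma orthogonal_schur_diagonal:
  fixes A :: "real mat"
  assumes "A \<in> carrier_mat n n"
    and "char_poly A = (\<Prod>e\<leftarrow>es. [:- e, 1:])"
  shows "\<exists>U \<in> carrier_mat n n. transpose_mat U * U = 1\<^sub>m n \<and> diag_mat (transpose_mat U * A * U) = es"
  using assms
proof (induction es arbitrary: n A)
  case Nil
  then have "n = 0"
    using degree_monic_char_poly[of A n] by auto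
  then show ?case
    using Nil by (intro bexI[of _ "1\<^sub>m n"]) (auto simp: diag_mat_def)
next
  case (Cons e es n A)
  define m where "m = n - 1"
  note A = Cons.prems(1)
  have cp: "char_poly A = [:- e, 1:] * (\<Prod>e\<leftarrow>es. [:- e, 1:])"
    using Cons.prems by simp
  have ev: "eigenvalue A e"
    unfolding eigenvalue_root_char_poly[OF A] cp by simp
  then obtain v where v: "v \<in> carrier_vec n" "v \<noteq> 0\<^sub>v n" "A *\<^sub>v v = e \<cdot>\<^sub>v v"
    using A unfolding eigenvalue_def eigenvector_def by auto
  have n: "n = 1 + m"
    using v unfolding m_def by (cases n) auto
  obtain W c where W: "W \<in> carrier_mat n n" and WW: "transpose_mat W * W = 1\<^sub>m n"
    and W0: "col W 0 = c \<cdot>\<^sub>v v"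
    using orthonormal_completion[OF v(1,2)] .
  have WW': "W * transpose_mat W = 1\<^sub>m n"
    by (rule orthogonal_mat_right[OF W WW])
  define A' where "A' = transpose_mat W * A * W"
  have A': "A' \<in> carrier_mat n n"
    unfolding A'_def using W A by auto
  have sim: "similar_mat A' A"
    unfolding similar_mat_def
    by (intro exI, rule similar_mat_witI[of "transpose_mat W" W n]) (use A' A W WW WW' in \<open>auto simp: A'_def\<close>)
  \<comment> \<open>The first column of \<open>W\<close> is a multiple of the eigenvector and the
    columns are orthonormal, so the first column of \<open>A'\<close> is \<open>e\<close> times the
    first unit vector.\<close>
  have col0: "A' $$ (i, 0) = (if i = 0 then e else 0)" if i: "i < n" for i
  proof -
    have n0: "0 < n" using n by simp
    have "A' $$ (i, 0) = col W i \<bullet> (A *\<^sub>v col W 0)"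
      unfolding A'_def by (rule index_conj_mat[OF A W i n0])
    also have "A *\<^sub>v col W 0 = e \<cdot>\<^sub>v col W 0"
      unfolding W0 using v A by (auto simp: mult_mat_vec smult_smult_assoc mult.commute)
    also have "col W i \<bullet> (e \<cdot>\<^sub>v col W 0) = e * (transpose_mat W * W) $$ (i, 0)"
      using W i n0 by auto
    also have "\<dots> = (if i = 0 then e else 0)"
      unfolding WW using i n0 by auto
    finally show ?thesis .
  qed
  obtain A1 A2 A0 A3 where split: "split_block A' 1 1 = (A1, A2, A0, A3)"
    by (cases "split_block A' 1 1") auto
  have "dim_row A' = 1 + m" "dim_col A' = 1 + m"
    using A' n by auto
  note blocks = split_block[OF split this]
  have A1: "A1 = mat 1 1 (\<lambda>_. e)"
    using split[unfolded split_block_def Let_def] col0[of 0] A' n by auto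
  have "A0 = mat m 1 (\<lambda>(i, j). A' $$ (i + 1, j))"
    using split[unfolded split_block_def Let_def] A' n by auto
  then have A0: "A0 = 0\<^sub>m m 1"
    using col0 n by (intro eq_matI) auto
  \<comment> \<open>Block triangularity factors the characteristic polynomial; cancelling the factor
    of the eigenvalue \<open>e\<close> leaves what the induction hypothesis requires of
    \<open>A3\<close>.\<close>
  have cpA3: "char_poly A3 = (\<Prod>e\<leftarrow>es. [:- e, 1:])"
  proof -
    have "char_poly A1 * char_poly A3 = [:- e, 1:] * (\<Prod>e\<leftarrow>es. [:- e, 1:])"
      using char_poly_similar[OF sim] cp blocks
        char_poly_four_block_zeros_col[OF blocks(1,2,4)] A0 by simp
    moreover have "char_poly A1 = [:- e, 1:]"
      by (simp add: A1 char_poly_defs det_def sign_def)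
    ultimately show ?thesis
      by (metis mult_cancel_left pCons_eq_0_iff zero_neq_one)
  qed
  from Cons.IH[OF blocks(4) cpA3] obtain P where P: "P \<in> carrier_mat m m"
    and PP: "transpose_mat P * P = 1\<^sub>m m" and diagP: "diag_mat (transpose_mat P * A3 * P) = es"
    by auto
  \<comment> \<open>\<open>F\<close> applies the orthogonal matrix from the induction hypothesis to
    the last \<open>m\<close> coordinates only, so conjugating by it keeps \<open>A1\<close> and the
    zero block. The final witness is \<open>W * F\<close>.\<close>
  define F where "F = four_block_mat (1\<^sub>m 1) (0\<^sub>m 1 m) (0\<^sub>m m 1) P"
  have F: "F \<in> carrier_mat n n"
    unfolding F_def n using P by auto
  have FT: "transpose_mat F = four_block_mat (1\<^sub>m 1) (0\<^sub>m 1 m) (0\<^sub>m m 1) (transpose_mat P)"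
    unfolding F_def using P by (subst transpose_four_block_mat) auto
  have FF: "transpose_mat F * F = 1\<^sub>m n"
    unfolding FT unfolding F_def n using P PP
    by (subst mult_four_block_mat[of _ 1 1 _ m _ m _ _ 1 _ m]) (auto simp: n)
  have FAF: "transpose_mat F * A' * F
      = four_block_mat A1 (A2 * P) (0\<^sub>m m 1) (transpose_mat P * A3 * P)"
  proof -
    have "transpose_mat F * A' = four_block_mat A1 A2 (0\<^sub>m m 1) (transpose_mat P * A3)"
      unfolding FT blocks(5) A0 using P blocks
      by (subst mult_four_block_mat[of _ 1 1 _ m _ m _ _ 1 _ m]) auto
    also have "\<dots> * F = four_block_mat A1 (A2 * P) (0\<^sub>m m 1) (transpose_mat P * A3 * P)"
      unfolding F_def using P blocks
      by (subst mult_four_block_mat[of _ 1 1 _ m _ m _ _ 1 _ m]) auto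
    finally show ?thesis .
  qed
  have "transpose_mat (W * F) * (W * F) = 1\<^sub>m n"
  proof -
    have "transpose_mat (W * F) * (W * F) = transpose_mat F * (transpose_mat W * W) * F"
      using W F by (simp add: transpose_mult[of _ n n] assoc_mult_mat[of _ n n _ n _ n])
    then show ?thesis using WW FF F by simp
  qed
  moreover have "diag_mat (transpose_mat (W * F) * A * (W * F)) = e # es"
  proof -
    have "transpose_mat (W * F) * A * (W * F) = transpose_mat F * A' * F"
      unfolding A'_def using W F A
      by (simp add: transpose_mult[of _ n n] assoc_mult_mat[of _ n n _ n _ n])
    also have "diag_mat \<dots> = diag_mat A1 @ diag_mat (transpose_mat P * A3 * P)"
      unfolding FAF using P blocks by (intro diag_four_block_mat) auto
    finally show ?thesis
      unfolding diagP by (simp add: A1 diag_mat_def)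
  qed
  ultimately show ?case
    using W F by (intro bexI[of _ "W * F"]) auto
qed

section \<open>Real spectrum of symmetric matrices\<close>

text \<open>The complex characteristic polynomial factors completely. Symmetry forces its roots to
  be real, and real polynomials embed injectively into complex ones, so the factorization descends
  to the reals.\<close>

lemma symmetric_char_poly_splits:
  fixes A :: "real mat"
  assumes A: "A \<in> carrier_mat n n" and sym: "transpose_mat A = A"
  shows "\<exists>es. char_poly A = (\<Prod>e\<leftarrow>es. [:- e, 1:]) \<and> length es = n"
proof -
  let ?C = "map_mat complex_of_real A"
  have C: "?C \<in> carrier_mat n n" using A by auto
  obtain as where as: "char_poly ?C = (\<Prod>a\<leftarrow>as. [:- a, 1:])" "length as = n"
    using char_poly_factorized[OF C] by auto
  have real: "cnj a = a" if a: "a \<in> set as" for a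
  proof -
    have "poly (char_poly ?C) a = 0"
      unfolding as poly_prod_list using a by (auto simp: prod_list_zero_iff o_def intro!: image_eqI)
    then have "eigenvalue ?C a"
      using eigenvalue_root_char_poly[OF C] by simp
    then obtain v where v: "v \<in> carrier_vec n" "v \<noteq> 0\<^sub>v n" "?C *\<^sub>v v = a \<cdot>\<^sub>v v"
      using C unfolding eigenvalue_def eigenvector_def by auto
    have cv: "conjugate v \<in> carrier_vec n" using v by auto
    have conjC: "?C *\<^sub>v conjugate v = conjugate (?C *\<^sub>v v)"
      using C v(1) by (intro eq_vecI) (auto simp: scalar_prod_def)
    \<comment> \<open>The Hermitian form at \<open>v\<close> is computed twice: \<open>?C\<close>
      acts first on \<open>v\<close> and then, moved across by symmetry, on its conjugate. As
      \<open>?C\<close> has real entries, the second computation yields \<open>cnj a\<close> in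
      place of \<open>a\<close>.\<close>
    have "a * (conjugate v \<bullet> v) = conjugate v \<bullet> (?C *\<^sub>v v)"
      using v cv by auto
    also have "\<dots> = (transpose_mat ?C *\<^sub>v conjugate v) \<bullet> v"
      using transpose_vec_mult_scalar[OF C v(1) cv] by simp
    also have "transpose_mat ?C = ?C"
      using sym A by (metis map_mat_transpose)
    also have "?C *\<^sub>v conjugate v = cnj a \<cdot>\<^sub>v conjugate v"
      unfolding conjC v by (simp add: conjugate_smult_vec)
    also have "(cnj a \<cdot>\<^sub>v conjugate v) \<bullet> v = cnj a * (conjugate v \<bullet> v)"
      using v cv by auto
    finally have "(a - cnj a) * (conjugate v \<bullet> v) = 0"
      by (simp add: algebra_simps)
    moreover have "conjugate v \<bullet> v \<noteq> 0"
      using conjugate_square_eq_0_vec[OF v(1)] v comm_scalar_prod[OF cv v(1)] by auto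
    ultimately show "cnj a = a" by simp
  qed
  define es where "es = map Re as"
  have as_es: "as = map complex_of_real es"
    unfolding es_def using real by (intro nth_equalityI) (auto simp: complex_eq_iff)
  interpret of_real_poly: map_poly_inj_idom_hom complex_of_real ..
  have "map_poly complex_of_real (char_poly A) = char_poly ?C"
    by (simp add: of_real_hom.char_poly_hom[OF A])
  also have "\<dots> = map_poly complex_of_real (\<Prod>e\<leftarrow>es. [:- e, 1:])"
    unfolding as as_es by (simp add: of_real_poly.hom_prod_list of_real_hom.map_poly_pCons_hom o_def)
  finally have "char_poly A = (\<Prod>e\<leftarrow>es. [:- e, 1:])"
    by simp
  moreover have "length es = n"
    unfolding es_def using as by simp
  ultimately show ?thesis by blast
qed


section \<open>Traces, norms and quadratic forms\<close>

definition trace :: "real mat \<Rightarrow> real" where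
  "trace A = (\<Sum>i<dim_row A. A $$ (i, i))"

lemma trace_eq_sum_list_diag: "trace A = sum_list (diag_mat A)"
  unfolding trace_def diag_mat_def by (simp add: interv_sum_list_conv_sum_set_nat atLeast0LessThan)

lemma trace_add:
  "A \<in> carrier_mat n n \<Longrightarrow> B \<in> carrier_mat n n \<Longrightarrow> trace (A + B) = trace A + trace B"
  by (auto simp: trace_def sum.distrib)

lemma trace_minus:
  "A \<in> carrier_mat n n \<Longrightarrow> B \<in> carrier_mat n n \<Longrightarrow> trace (A - B) = trace A - trace B"
  by (auto simp: trace_def sum_subtractf)

lemma trace_comm:
  assumes A: "A \<in> carrier_mat n m" and B: "B \<in> carrier_mat m n"
  shows "trace (A * B) = trace (B * A)"
proof -
  have "trace (A * B) = (\<Sum>i<n. \<Sum>j<m. A $$ (i, j) * B $$ (j, i))"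
    using A B by (simp add: trace_def scalar_prod_def atLeast0LessThan)
  also have "\<dots> = (\<Sum>j<m. \<Sum>i<n. B $$ (j, i) * A $$ (i, j))"
    by (subst sum.swap) (simp add: mult.commute)
  also have "\<dots> = trace (B * A)"
    using A B by (simp add: trace_def scalar_prod_def atLeast0LessThan)
  finally show ?thesis .
qed

text \<open>Cyclicity of the trace brings \<open>U\<close> next to its transpose. The trace can thus
  be computed in any orthonormal frame.\<close>

lemma trace_orthogonal_conj:
  assumes A: "A \<in> carrier_mat n n" and U: "U \<in> carrier_mat n n" "transpose_mat U * U = 1\<^sub>m n"
  shows "trace (transpose_mat U * A * U) = trace A"
proof -
  have "trace (transpose_mat U * A * U) = trace (U * (transpose_mat U * A))"
    using A U by (intro trace_comm[of _ n n]) auto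
  also have "U * (transpose_mat U * A) = A"
    using A U orthogonal_mat_right[OF U] by (simp flip: assoc_mult_mat[of U n n _ n _ n])
  finally show ?thesis .
qed

lemma orthogonal_scalar_prod:
  fixes U :: "real mat"
  assumes U: "U \<in> carrier_mat n n" "transpose_mat U * U = 1\<^sub>m n"
    and x: "x \<in> carrier_vec n" and y: "y \<in> carrier_vec n"
  shows "(U *\<^sub>v x) \<bullet> (U *\<^sub>v y) = x \<bullet> y"
proof -
  have "(U *\<^sub>v x) \<bullet> (U *\<^sub>v y) = (transpose_mat U *\<^sub>v (U *\<^sub>v x)) \<bullet> y"
    using transpose_vec_mult_scalar[of U n n y "U *\<^sub>v x"] assms by simp
  also have "transpose_mat U *\<^sub>v (U *\<^sub>v x) = x"
    using U x by (simp flip: assoc_mult_mat_vec[of _ n n])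
  finally show ?thesis .
qed

section \<open>Euclidean and spectral norms\<close>

lemma euclidean_norm_eq_L2_set: "euclidean_norm v = L2_set (($) v) {..<dim_vec v}"
  unfolding euclidean_norm_def L2_set_def scalar_prod_def
  by (simp add: power2_eq_square atLeast0LessThan)

lemma euclidean_norm_add_le:
  assumes "v \<in> carrier_vec n" "w \<in> carrier_vec n"
  shows "euclidean_norm (v + w) \<le> euclidean_norm v + euclidean_norm w"
proof -
  have "euclidean_norm (v + w) = L2_set (\<lambda>i. v $ i + w $ i) {..<n}"
    unfolding euclidean_norm_eq_L2_set using assms by (intro L2_set_cong) auto
  then show ?thesis
    using L2_set_triangle_ineq[of "($) v" "($) w" "{..<n}"] assms
    by (simp add: euclidean_norm_eq_L2_set)
qed

lemma scalar_prod_le_euclidean_norm: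
  assumes "v \<in> carrier_vec n" "w \<in> carrier_vec n"
  shows "v \<bullet> w \<le> euclidean_norm v * euclidean_norm w"
proof -
  have "v \<bullet> w \<le> (\<Sum>i<n. \<bar>v $ i\<bar> * \<bar>w $ i\<bar>)"
    using assms by (auto simp: scalar_prod_def atLeast0LessThan abs_mult[symmetric] intro!: sum_mono)
  also have "\<dots> \<le> euclidean_norm v * euclidean_norm w"
    using L2_set_mult_ineq[of "($) v" "($) w" "{..<n}"] assms
    by (simp add: euclidean_norm_eq_L2_set)
  finally show ?thesis .
qed

text \<open>The bound is applied on the unit sphere. Bounding the supremum requires this sphere to
  be nonempty, which the first unit vector ensures when \<open>n\<close> is positive.\<close>

lemma spectral_norm_le:
  assumes A: "A \<in> carrier_mat n n" and n: "n \<ge> 1"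
    and le: "\<And>v. v \<in> carrier_vec n \<Longrightarrow> euclidean_norm (A *\<^sub>v v) \<le> c * euclidean_norm v"
  shows "spectral_norm A \<le> c"
proof -
  have "euclidean_norm (unit_vec n 0) = 1"
    using n by (simp add: euclidean_norm_def)
  then have "{v \<in> carrier_vec (dim_col A). euclidean_norm v = 1} \<noteq> {}"
    using A n by (auto intro!: exI[of _ "unit_vec n 0"])
  then show ?thesis
    unfolding spectral_norm_def using A le by (intro cSUP_least) force+
qed

section \<open>Sorted eigenvalue lists\<close>

lemma proots_prod_list_linear: "proots (\<Prod>e\<leftarrow>es. [:- e, 1:]) = mset (es :: 'a :: idom list)"
proof (induction es)
  case (Cons e es)
  have "(\<Prod>e\<leftarrow>es. [:- e, 1:]) \<noteq> 0"
    by (auto simp: prod_list_zero_iff)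
  then show ?case
    using Cons by (simp add: proots_mult del: mult_pCons_left)
qed simp

text \<open>Any complete linear factorization determines the eigenvalues up to order, so the
  diagonal of any diagonalization is a permutation of the sorted list.\<close>

lemma mset_eigenvalues_desc:
  assumes "char_poly A = (\<Prod>e\<leftarrow>es. [:- e, 1:])"
  shows "mset (eigenvalues_desc A) = mset es"
  unfolding eigenvalues_desc_def assms by (simp add: proots_prod_list_linear)

lemma sorted_rev_eigenvalues_desc: "sorted (rev (eigenvalues_desc A))"
  unfolding eigenvalues_desc_def by simp

text \<open>The first \<open>l\<close> entries of a decreasing list are at least the
  \<open>l\<close>-th, so each of these minima equals it; the remaining minima are nonnegative. This
  is the source of the factor \<open>l\<close> in the trace bound.\<close>

lemma sum_list_min_ge:
  fixes xs :: "real list"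
  assumes sorted: "sorted (rev xs)" and nonneg: "\<And>x. x \<in> set xs \<Longrightarrow> 0 \<le> x"
    and l: "1 \<le> l" "l \<le> length xs"
  shows "real l * xs ! (l - 1) \<le> (\<Sum>x\<leftarrow>xs. min x (xs ! (l - 1)))"
proof -
  let ?e = "xs ! (l - 1)"
  have "?e \<in> set xs" using l by (intro nth_mem) auto
  then have e: "0 \<le> ?e" by (rule nonneg)
  have "real l * ?e = (\<Sum>i<l. ?e)" by simp
  also have "\<dots> \<le> (\<Sum>i<l. min (xs ! i) ?e)"
    using sorted_rev_nth_mono[OF sorted] l by (intro sum_mono) auto
  also have "\<dots> \<le> (\<Sum>i<length xs. min (xs ! i) ?e)"
    using l e nonneg by (intro sum_mono2) auto
  also have "\<dots> = (\<Sum>x\<leftarrow>xs. min x ?e)"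
    by (simp add: sum_list_sum_nth atLeast0LessThan)
  finally show ?thesis .
qed

section \<open>Conjugates of diagonal matrices\<close>

lemma diagonal_mult_mat_vec:
  fixes D :: "real mat"
  assumes D: "D \<in> carrier_mat n n" "diagonal_mat D" and y: "y \<in> carrier_vec n"
  shows "D *\<^sub>v y = vec n (\<lambda>i. D $$ (i, i) * y $ i)"
proof (rule eq_vecI)
  fix i assume "i < dim_vec (vec n (\<lambda>i. D $$ (i, i) * y $ i))"
  then have i: "i < n" by simp
  have "(D *\<^sub>v y) $ i = (\<Sum>j<n. D $$ (i, j) * y $ j)"
    using D y i by (simp add: scalar_prod_def atLeast0LessThan)
  also have "\<dots> = (\<Sum>j<n. if j = i then D $$ (i, i) * y $ i else 0)"
    using D i unfolding diagonal_mat_def by (intro sum.cong) auto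
  finally show "(D *\<^sub>v y) $ i = vec n (\<lambda>i. D $$ (i, i) * y $ i) $ i"
    using i by simp
qed (use D in auto)

text \<open>Moving \<open>U\<close> across the scalar product turns the form into a sum of squared
  coordinates weighted by the diagonal of \<open>D\<close>.\<close>

lemma diagonal_conj_quadratic_form_nonneg:
  fixes D :: "real mat"
  assumes D: "D \<in> carrier_mat n n" "diagonal_mat D" and U: "U \<in> carrier_mat n n"
    and nonneg: "\<And>i. i < n \<Longrightarrow> 0 \<le> D $$ (i, i)" and v: "v \<in> carrier_vec n"
  shows "0 \<le> v \<bullet> ((U * D * transpose_mat U) *\<^sub>v v)"
proof -
  let ?y = "transpose_mat U *\<^sub>v v"
  have y: "?y \<in> carrier_vec n" using U v by auto
  have "v \<bullet> ((U * D * transpose_mat U) *\<^sub>v v) = v \<bullet> (U *\<^sub>v (D *\<^sub>v ?y))"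
    using D U v y by (simp add: assoc_mult_mat_vec[of _ n n _ n])
  also have "\<dots> = ?y \<bullet> (D *\<^sub>v ?y)"
    using transpose_vec_mult_scalar[of U n n "D *\<^sub>v ?y" v] U v D y by simp
  also have "\<dots> = (\<Sum>i<n. D $$ (i, i) * (?y $ i)\<^sup>2)"
    unfolding diagonal_mult_mat_vec[OF D y]
    by (simp add: scalar_prod_def atLeast0LessThan power2_eq_square algebra_simps)
  also have "\<dots> \<ge> 0"
    using nonneg by (intro sum_nonneg) auto
  finally show ?thesis .
qed

text \<open>\<open>U\<close> and its transpose preserve length, so only \<open>D\<close> can stretch
  a vector, each coordinate by a factor of at most \<open>c\<close>.\<close>

lemma diagonal_conj_norm_le:
  fixes D :: "real mat"
  assumes D: "D \<in> carrier_mat n n" "diagonal_mat D"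
    and U: "U \<in> carrier_mat n n" "transpose_mat U * U = 1\<^sub>m n"
    and bound: "\<And>i. i < n \<Longrightarrow> \<bar>D $$ (i, i)\<bar> \<le> c" and v: "v \<in> carrier_vec n" and c: "0 \<le> c"
  shows "euclidean_norm ((U * D * transpose_mat U) *\<^sub>v v) \<le> c * euclidean_norm v"
proof -
  let ?y = "transpose_mat U *\<^sub>v v"
  have y: "?y \<in> carrier_vec n" using U v by auto
  have yy: "?y \<bullet> ?y = v \<bullet> v"
    using orthogonal_scalar_prod[of "transpose_mat U" n v v] U v orthogonal_mat_right[OF U] by simp
  have "euclidean_norm ((U * D * transpose_mat U) *\<^sub>v v) = euclidean_norm (U *\<^sub>v (D *\<^sub>v ?y))"
    using D U v y by (simp add: assoc_mult_mat_vec[of _ n n _ n])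
  also have "\<dots> = euclidean_norm (D *\<^sub>v ?y)"
    unfolding euclidean_norm_def using D y U by (subst orthogonal_scalar_prod) auto
  also have "\<dots> = L2_set (\<lambda>i. D $$ (i, i) * ?y $ i) {..<n}"
    unfolding diagonal_mult_mat_vec[OF D y] euclidean_norm_eq_L2_set by (intro L2_set_cong) auto
  also have "\<dots> = L2_set (\<lambda>i. \<bar>D $$ (i, i)\<bar> * \<bar>?y $ i\<bar>) {..<n}"
    by (simp add: L2_set_def power_mult_distrib)
  also have "\<dots> \<le> L2_set (\<lambda>i. c * \<bar>?y $ i\<bar>) {..<n}"
    using bound by (intro L2_set_mono mult_right_mono) auto
  also have "\<dots> = c * L2_set (\<lambda>i. \<bar>?y $ i\<bar>) {..<n}"
    using c by (simp add: L2_set_right_distrib)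
  also have "L2_set (\<lambda>i. \<bar>?y $ i\<bar>) {..<n} = euclidean_norm ?y"
    using U by (simp add: euclidean_norm_eq_L2_set L2_set_def)
  also have "\<dots> = euclidean_norm v"
    unfolding euclidean_norm_def yy ..
  finally show ?thesis .
qed


section \<open>Positive semidefinite matrices\<close>

text \<open>Records the dimension and the sign of the quadratic form; symmetry is not included in
  the predicate.\<close>

definition pos_semidef :: "nat \<Rightarrow> real mat \<Rightarrow> bool" where
  "pos_semidef n A \<longleftrightarrow> A \<in> carrier_mat n n \<and> (\<forall>v \<in> carrier_vec n. 0 \<le> v \<bullet> (A *\<^sub>v v))"

lemma pos_semidef_zero: "pos_semidef n (0\<^sub>m n n)"
  by (auto simp: pos_semidef_def scalar_prod_def)

lemma pos_semidef_add:
  assumes "pos_semidef n A" "pos_semidef n B"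
  shows "pos_semidef n (A + B)"
  using assms unfolding pos_semidef_def
  by (auto simp: add_mult_distrib_mat_vec[of _ n n] scalar_prod_add_distrib[of _ n])

lemma pos_semidef_gram:
  fixes Y :: "real mat"
  assumes Y: "Y \<in> carrier_mat n m"
  shows "pos_semidef n (Y * transpose_mat Y)"
proof -
  have "v \<bullet> ((Y * transpose_mat Y) *\<^sub>v v) \<ge> 0" if v: "v \<in> carrier_vec n" for v
  proof -
    let ?y = "transpose_mat Y *\<^sub>v v"
    have "v \<bullet> ((Y * transpose_mat Y) *\<^sub>v v) = ?y \<bullet> ?y"
      using transpose_vec_mult_scalar[of Y n m ?y v] Y v
      by (simp add: assoc_mult_mat_vec[of _ n m _ n])
    then show ?thesis
      by (simp add: scalar_prod_def sum_nonneg)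
  qed
  then show ?thesis
    unfolding pos_semidef_def using Y by auto
qed

section \<open>Frequent Directions\<close>

text \<open>Since \<open>x - max (x - e) 0 = min x e\<close>, the removed matrix
  \<open>M - B\<close> is \<open>M\<close> with its eigenvalues capped at \<open>e\<close>. As
  \<open>M\<close> is positive semidefinite, they lie between \<open>0\<close> and \<open>e\<close>,
  which gives the norm bound; the \<open>l\<close> largest all become \<open>e\<close>, which gives
  the trace bound.\<close>

lemma fd_step_properties:
  assumes A: "pos_semidef d A" and Y: "Y \<in> carrier_mat d m"
    and step: "fd_step d l Y A B" and l: "1 \<le> l" "l \<le> d"
  defines "M \<equiv> A + Y * transpose_mat Y"
  defines "e \<equiv> nth_eigenvalue M l"
  shows "pos_semidef d B" and "0 \<le> e"
    and "\<And>v. v \<in> carrier_vec d \<Longrightarrow> euclidean_norm ((M - B) *\<^sub>v v) \<le> e * euclidean_norm v"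
    and "real l * e \<le> trace (M - B)"
proof -
  have "pos_semidef d M"
    unfolding M_def using pos_semidef_add[OF A pos_semidef_gram[OF Y]] .
  then have M: "M \<in> carrier_mat d d" and psdM: "\<And>v. v \<in> carrier_vec d \<Longrightarrow> 0 \<le> v \<bullet> (M *\<^sub>v v)"
    unfolding pos_semidef_def by auto
  obtain U L where U: "U \<in> carrier_mat d d" and L: "L \<in> carrier_mat d d"
    and UU: "transpose_mat U * U = 1\<^sub>m d" and UU': "U * transpose_mat U = 1\<^sub>m d"
    and diagL: "diagonal_mat L" and M_eq: "M = U * L * transpose_mat U"
    and B_eq: "B = U * map_mat (\<lambda>x. max x 0) (L - e \<cdot>\<^sub>m 1\<^sub>m d) * transpose_mat U"
    using step unfolding fd_step_def is_eigendecomposition_def M_def e_def by auto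
  define D where "D = map_mat (\<lambda>x. max x 0) (L - e \<cdot>\<^sub>m 1\<^sub>m d)"
  have D: "D \<in> carrier_mat d d" and diagD: "diagonal_mat D"
    and Dii: "\<And>i. i < d \<Longrightarrow> D $$ (i, i) = max (L $$ (i, i) - e) 0"
    using L diagL unfolding D_def diagonal_mat_def by auto
  define E where "E = L - D"
  have E: "E \<in> carrier_mat d d" and diagE: "diagonal_mat E"
    and Eii: "\<And>i. i < d \<Longrightarrow> E $$ (i, i) = min (L $$ (i, i)) e"
    using L D diagL diagD Dii unfolding E_def diagonal_mat_def by auto
  have M_minus_B: "M - B = U * E * transpose_mat U"
    unfolding M_eq B_eq E_def D_def[symmetric] using U L D
    by (simp add: mult_minus_distrib_mat[of U d d] minus_mult_distrib_mat[of _ d d])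
  \<comment> \<open>Inverting the decomposition exhibits the diagonal of \<open>L\<close> as values
    of the nonnegative quadratic form of \<open>M\<close> on the columns of
    \<open>U\<close>.\<close>
  have "transpose_mat U * M * U = transpose_mat U * U * L * (transpose_mat U * U)"
    unfolding M_eq using U L by (simp add: assoc_mult_mat[of _ d d _ d _ d])
  then have L_eq: "L = transpose_mat U * M * U"
    using L by (simp add: UU)
  have Lii: "0 \<le> L $$ (i, i)" if i: "i < d" for i
    unfolding L_eq index_conj_mat[OF M U i i] using U i by (intro psdM) auto
  have "similar_mat M L"
    unfolding similar_mat_def
    by (intro exI, rule similar_mat_witI[of U "transpose_mat U" d]) (use M L U UU UU' M_eq in auto)
  then have "char_poly M = (\<Prod>e\<leftarrow>diag_mat L. [:- e, 1:])"
    using char_poly_upper_triangular[OF L] diagL L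
    unfolding diagonal_mat_def upper_triangular_def by (subst char_poly_similar) auto
  note eigs = mset_eigenvalues_desc[OF this]
  define xs where "xs = eigenvalues_desc M"
  \<comment> \<open>The decomposition may list the eigenvalues in any order, whereas the threshold
    refers to the sorted list. Equality of multisets suffices to compare sums.\<close>
  have xs: "mset xs = mset (diag_mat L)"
    unfolding xs_def by (rule eigs)
  have len: "length xs = d"
    using mset_eq_length[OF xs] L by (simp add: diag_mat_def)
  have nonneg: "0 \<le> x" if "x \<in> set xs" for x
    using mset_eq_setD[OF xs] that Lii L by (auto simp: diag_mat_def)
  have e_xs: "e = xs ! (l - 1)"
    unfolding e_def nth_eigenvalue_def xs_def ..
  then show e: "0 \<le> e"
    using nonneg[of e] l len by auto
  show "pos_semidef d B"
    unfolding pos_semidef_def B_eq D_def[symmetric]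
    using diagonal_conj_quadratic_form_nonneg[OF D diagD U] Dii D U by auto
  show "euclidean_norm ((M - B) *\<^sub>v v) \<le> e * euclidean_norm v" if "v \<in> carrier_vec d" for v
    unfolding M_minus_B using Eii e Lii
    by (intro diagonal_conj_norm_le[OF E diagE U UU _ that]) auto
  have "sorted (rev xs)"
    unfolding xs_def by (rule sorted_rev_eigenvalues_desc)
  then have "real l * e \<le> (\<Sum>x\<leftarrow>xs. min x e)"
    unfolding e_xs using nonneg l len by (intro sum_list_min_ge) auto
  also have "\<dots> = (\<Sum>x\<leftarrow>diag_mat L. min x e)"
    using xs by (metis mset_map sum_mset_sum_list)
  also have "\<dots> = trace E"
    using L E Eii by (simp add: trace_def diag_mat_def o_def interv_sum_list_conv_sum_set_nat atLeast0LessThan)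
  \<comment> \<open>The orthogonal matrix conjugated with is the transpose of \<open>U\<close>,
    hence the double transpose.\<close>
  also have "\<dots> = trace (transpose_mat (transpose_mat U) * E * transpose_mat U)"
    using E U UU' by (subst trace_orthogonal_conj) auto
  finally show "real l * e \<le> trace (M - B)"
    unfolding M_minus_B by simp
qed

section \<open>Stream covariance and accumulated error\<close>

lemma stream_covariance_carrier: "stream_covariance d t X \<in> carrier_mat d d"
  unfolding stream_covariance_def by simp

lemma stream_covariance_0: "stream_covariance d 0 X = 0\<^sub>m d d"
  unfolding stream_covariance_def by auto

lemma stream_covariance_Suc:
  assumes "X (Suc t) \<in> carrier_mat d m"
  shows "stream_covariance d (Suc t) X
    = stream_covariance d t X + X (Suc t) * transpose_mat (X (Suc t))"
  using assms unfolding stream_covariance_def by (intro eq_matI) auto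

lemma transpose_stream_covariance:
  assumes "\<And>t. t \<in> {1..T} \<Longrightarrow> X t \<in> carrier_mat d (n t)"
  shows "transpose_mat (stream_covariance d T X) = stream_covariance d T X"
proof (rule eq_matI)
  fix i j
  assume "i < dim_row (stream_covariance d T X)" "j < dim_col (stream_covariance d T X)"
  then have ij: "i < d" "j < d"
    by (auto simp: stream_covariance_def)
  have "(X t * transpose_mat (X t)) $$ (j, i) = (X t * transpose_mat (X t)) $$ (i, j)"
    if "t \<in> {1..T}" for t
    using assms[OF that] ij by (auto intro!: comm_scalar_prod[of _ "n t"])
  then show "transpose_mat (stream_covariance d T X) $$ (i, j) = stream_covariance d T X $$ (i, j)"
    using ij by (simp add: stream_covariance_def)
qed (auto simp: stream_covariance_def)

text \<open>The error telescopes into the matrices removed by the single steps: norm bounds add up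
  by the triangle inequality, trace bounds by linearity. Positive semidefiniteness of
  \<open>Ct t\<close> is carried along because the next step's bounds rely on it.\<close>

lemma frequent_directions_error:
  assumes fd: "frequent_directions d l T X Ct"
    and X: "\<And>t. t \<in> {1..T} \<Longrightarrow> X t \<in> carrier_mat d (n t)"
    and l: "1 \<le> l" "l \<le> d"
  defines "\<delta> \<equiv> \<lambda>t. \<Sum>s = 1..t. nth_eigenvalue (Ct (s - 1) + X s * transpose_mat (X s)) l"
  assumes "t \<le> T"
  shows "pos_semidef d (Ct t)
    \<and> (\<forall>v \<in> carrier_vec d.
         euclidean_norm ((stream_covariance d t X - Ct t) *\<^sub>v v) \<le> \<delta> t * euclidean_norm v)
    \<and> real l * \<delta> t \<le> trace (stream_covariance d t X - Ct t)"
  using \<open>t \<le> T\<close>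
proof (induction t)
  case 0
  have Ct0: "Ct 0 = 0\<^sub>m d d"
    using fd unfolding frequent_directions_def by simp
  then have diff: "stream_covariance d 0 X - Ct 0 = 0\<^sub>m d d"
    by (auto simp: stream_covariance_0)
  have "euclidean_norm (0\<^sub>m d d *\<^sub>v v) = 0" if "v \<in> carrier_vec d" for v
    using that by (simp add: euclidean_norm_def scalar_prod_def)
  then show ?case
    unfolding diff unfolding Ct0 by (simp add: pos_semidef_zero \<delta>_def trace_def)
next
  case (Suc t)
  let ?S = "stream_covariance d t X" and ?S' = "stream_covariance d (Suc t) X"
  let ?XX = "X (Suc t) * transpose_mat (X (Suc t))"
  let ?e = "nth_eigenvalue (Ct t + ?XX) l"
  have Xt: "X (Suc t) \<in> carrier_mat d (n (Suc t))"
    using Suc.prems by (intro X) auto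
  have psd: "pos_semidef d (Ct t)"
    and norm: "\<And>v. v \<in> carrier_vec d \<Longrightarrow> euclidean_norm ((?S - Ct t) *\<^sub>v v) \<le> \<delta> t * euclidean_norm v"
    and tr: "real l * \<delta> t \<le> trace (?S - Ct t)"
    using Suc by auto
  have "fd_step d l (X (Suc t)) (Ct t) (Ct (Suc t))"
    using fd Suc.prems unfolding frequent_directions_def by force
  note step = fd_step_properties[OF psd Xt this l]
  have C: "Ct t \<in> carrier_mat d d" and C': "Ct (Suc t) \<in> carrier_mat d d"
    and S: "?S \<in> carrier_mat d d"
    using psd step(1) stream_covariance_carrier unfolding pos_semidef_def by auto
  \<comment> \<open>Inserting \<open>Ct t\<close> separates the old error from what the current step
    removes.\<close>
  have split: "?S' - Ct (Suc t) = (?S - Ct t) + (Ct t + ?XX - Ct (Suc t))"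
    unfolding stream_covariance_Suc[of X t d, OF Xt] using Xt C C' S by (intro eq_matI) auto
  have \<delta>: "\<delta> (Suc t) = \<delta> t + ?e"
    unfolding \<delta>_def by simp
  have "euclidean_norm ((?S' - Ct (Suc t)) *\<^sub>v v) \<le> \<delta> (Suc t) * euclidean_norm v"
    if v: "v \<in> carrier_vec d" for v
  proof -
    have "euclidean_norm ((?S' - Ct (Suc t)) *\<^sub>v v)
        = euclidean_norm ((?S - Ct t) *\<^sub>v v + (Ct t + ?XX - Ct (Suc t)) *\<^sub>v v)"
      unfolding split using v C C' S Xt by (subst add_mult_distrib_mat_vec[of _ d d]) auto
    also have "\<dots> \<le> euclidean_norm ((?S - Ct t) *\<^sub>v v)
        + euclidean_norm ((Ct t + ?XX - Ct (Suc t)) *\<^sub>v v)"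
      using C C' S Xt v by (intro euclidean_norm_add_le[of _ d] mult_mat_vec_carrier[of _ d d]) auto
    also have "\<dots> \<le> \<delta> (Suc t) * euclidean_norm v"
      using norm[OF v] step(3)[OF v] unfolding \<delta> by (simp add: algebra_simps)
    finally show ?thesis .
  qed
  moreover have "real l * \<delta> (Suc t) \<le> trace (?S' - Ct (Suc t))"
  proof -
    have "trace (?S' - Ct (Suc t)) = trace (?S - Ct t) + trace (Ct t + ?XX - Ct (Suc t))"
      unfolding split using C C' S Xt by (intro trace_add[of _ d]) auto
    then show ?thesis
      using tr step(4) unfolding \<delta> by (simp add: algebra_simps)
  qed
  ultimately show ?case
    using step(1) by auto
qed

section \<open>Comparison with the spectrum of the covariance\<close>

text \<open>Triangularization accepts the roots in any prescribed order. Prescribing the decreasing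
  one makes the first \<open>k\<close> columns of \<open>U\<close> carry the \<open>k\<close>
  largest eigenvalues as quadratic form values.\<close>

lemma symmetric_eigenvalue_frame:
  fixes A :: "real mat"
  assumes A: "A \<in> carrier_mat n n" and sym: "transpose_mat A = A"
  obtains U where "U \<in> carrier_mat n n" "transpose_mat U * U = 1\<^sub>m n"
    "diag_mat (transpose_mat U * A * U) = eigenvalues_desc A"
proof -
  obtain es where es: "char_poly A = (\<Prod>e\<leftarrow>es. [:- e, 1:])"
    using symmetric_char_poly_splits[OF A sym] by auto
  then have "char_poly A = (\<Prod>e\<leftarrow>eigenvalues_desc A. [:- e, 1:])"
    using mset_eigenvalues_desc[OF es] by (metis mset_map prod_mset_prod_list)
  then show thesis
    using orthogonal_schur_diagonal[OF A] that by blast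
qed

theorem lemma1:
  fixes d T l :: nat
    and n :: "nat \<Rightarrow> nat"
    and X Ct :: "nat \<Rightarrow> real mat"
  assumes "d \<ge> 1" and "T \<ge> 1"
    and "1 \<le> l" and "l \<le> d"
    and "\<forall>t \<in> {1..T}. n t \<ge> 1 \<and> X t \<in> carrier_mat d (n t)"
    and "frequent_directions d l T X Ct"
  shows "\<forall>k < l. spectral_norm (stream_covariance d T X - Ct T)
           \<le> 1 / (real l - real k) *
               (\<Sum>i = k + 1..d. nth_eigenvalue (stream_covariance d T X) i)"
proof (intro allI impI)
  fix k assume k: "k < l"
  define C where "C = stream_covariance d T X"
  define M where "M = C - Ct T"
  define es where "es = eigenvalues_desc C"
  have X: "X t \<in> carrier_mat d (n t)" if "t \<in> {1..T}" for t
    using assms(5) that by blast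
  have C: "C \<in> carrier_mat d d"
    unfolding C_def by (rule stream_covariance_carrier)
  \<comment> \<open>The sum of the thresholds enters the rest of the argument only through these
    three facts.\<close>
  obtain \<delta> where psd: "pos_semidef d (Ct T)"
    and norm: "\<And>v. v \<in> carrier_vec d \<Longrightarrow> euclidean_norm (M *\<^sub>v v) \<le> \<delta> * euclidean_norm v"
    and tr: "real l * \<delta> \<le> trace M"
    using frequent_directions_error[OF assms(6) X assms(3,4) order_refl] unfolding M_def C_def by blast
  then have CT: "Ct T \<in> carrier_mat d d"
    and quad_nonneg: "\<And>v. v \<in> carrier_vec d \<Longrightarrow> 0 \<le> v \<bullet> (Ct T *\<^sub>v v)"
    unfolding pos_semidef_def by auto
  have M: "M \<in> carrier_mat d d"
    unfolding M_def using C CT by auto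
  obtain U where U: "U \<in> carrier_mat d d" and UU: "transpose_mat U * U = 1\<^sub>m d"
    and diag: "diag_mat (transpose_mat U * C * U) = es"
    unfolding es_def
    using symmetric_eigenvalue_frame[OF C] transpose_stream_covariance[of T X d n, OF X]
    unfolding C_def by blast
  have u: "col U i \<in> carrier_vec d" if "i < d" for i
    using U that by auto
  have es_nth: "es ! i = col U i \<bullet> (C *\<^sub>v col U i)" if "i < d" for i
    using index_conj_mat[OF C U that that] that U unfolding diag[symmetric] by (simp add: diag_mat_def)
  have len: "length es = d"
    unfolding diag[symmetric] using U by (simp add: diag_mat_def)
  have trC: "trace C = (\<Sum>i<d. es ! i)"
    using trace_orthogonal_conj[OF C U UU] unfolding trace_eq_sum_list_diag diag
    by (simp add: sum_list_sum_nth len atLeast0LessThan)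
  \<comment> \<open>Cauchy-Schwarz for a unit vector turns the norm bound on \<open>M\<close> into a
    bound on its quadratic form.\<close>
  have quad_M: "col U i \<bullet> (M *\<^sub>v col U i) \<le> \<delta>" if i: "i < d" for i
  proof -
    have "col U i \<bullet> col U i = (transpose_mat U * U) $$ (i, i)"
      using U i by simp
    then have "euclidean_norm (col U i) = 1"
      unfolding UU euclidean_norm_def using i by simp
    then show ?thesis
      using scalar_prod_le_euclidean_norm[of "col U i" d "M *\<^sub>v col U i"] norm[OF u[OF i]] M u[OF i]
      by simp
  qed
  have "(\<Sum>i<k. es ! i - \<delta>) \<le> (\<Sum>i<k. col U i \<bullet> (Ct T *\<^sub>v col U i))"
  proof (rule sum_mono)
    fix i assume "i \<in> {..<k}"
    then have i: "i < d" using k assms(4) by simp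
    have "col U i \<bullet> (M *\<^sub>v col U i) = es ! i - col U i \<bullet> (Ct T *\<^sub>v col U i)"
      unfolding M_def es_nth[OF i] using C CT u[OF i]
      by (simp add: minus_mult_distrib_mat_vec[of _ d d] scalar_prod_minus_distrib[of _ d])
    then show "es ! i - \<delta> \<le> col U i \<bullet> (Ct T *\<^sub>v col U i)"
      using quad_M[OF i] by simp
  qed
  \<comment> \<open>The directions from \<open>k\<close> on add nonnegative terms, and the completed
    sum runs over a full orthonormal frame, so it is the trace of \<open>Ct T\<close>.\<close>
  also have "\<dots> \<le> (\<Sum>i<d. col U i \<bullet> (Ct T *\<^sub>v col U i))"
    using k assms(4) quad_nonneg[OF u] by (intro sum_mono2) auto
  also have "\<dots> = trace (transpose_mat U * Ct T * U)"
    unfolding trace_def using U by (intro sum.cong index_conj_mat[OF CT U, symmetric]) auto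
  also have "\<dots> = trace (Ct T)"
    by (rule trace_orthogonal_conj[OF CT U UU])
  finally have "(\<Sum>i<k. es ! i) - real k * \<delta> \<le> trace (Ct T)"
    by (simp add: sum_subtractf)
  moreover have "trace M = (\<Sum>i<k. es ! i) + (\<Sum>i = k..<d. es ! i) - trace (Ct T)"
    unfolding M_def using trace_minus[OF C CT] trC k assms(4)
    by (simp flip: atLeast0LessThan add: sum.atLeastLessThan_concat)
  \<comment> \<open>The top \<open>k\<close> eigenvalues cancel: \<open>l * \<delta>\<close> is at
    most \<open>trace M\<close>, which is at most the tail sum plus
    \<open>k * \<delta>\<close>.\<close>
  ultimately have "(real l - real k) * \<delta> \<le> (\<Sum>i = k..<d. es ! i)"
    using tr by (simp add: algebra_simps)
  then have "\<delta> \<le> 1 / (real l - real k) * (\<Sum>i = k..<d. es ! i)"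
    using k by (simp add: field_simps)
  \<comment> \<open>Shifts from list positions, counted from 0, to eigenvalue indices, counted from
    1.\<close>
  also have "(\<Sum>i = k..<d. es ! i) = (\<Sum>i = k + 1..d. nth_eigenvalue C i)"
    unfolding nth_eigenvalue_def es_def[symmetric]
    using sum.shift_bounds_Suc_ivl[of "\<lambda>i. es ! (i - 1)" k d]
    by (simp add: atLeastLessThanSuc_atLeastAtMost)
  finally show "spectral_norm (stream_covariance d T X - Ct T)
      \<le> 1 / (real l - real k) * (\<Sum>i = k + 1..d. nth_eigenvalue (stream_covariance d T X) i)"
    using spectral_norm_le[OF M assms(1) norm] unfolding M_def C_def by simp
qed

end
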